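(* Let $\mathcal{H}$ be a real Hilbert space and let $T:\mathcal{H}\to\mathcal{H}$ be monotone, $L$-Lipschitz continuous ($L\ge0$) and affine, $Tx=T^lx+c$ with $T^l:\mathcal{H}\to\mathcal{H}$ linear and $c\in\mathcal{H}$. Let $\theta,w\in\mathcal{H}$, $\Delta>0$, and put $\zeta=T\theta$. For $\rho>0$ let $x_\rho=\theta-\rho(\zeta-w)$ and $y_\rho=Tx_\rho$. Then: (1) $y_\rho=\zeta-\rho\,T^l(\zeta-w)$ for every $\rho>0$. (2) If $\zeta\ne w$, define $$\tilde\rho=\frac{\|\zeta-w\|^2}{\Delta\|\zeta-w\|^2+\langle\zeta-w,T^l(\zeta-w)\rangle}.$$ Then $\tilde\rho\in\left[\frac{1}{\Delta+L},\frac1\Delta\right]$, and for every $\rho$ with $0<\rho\le\tilde\rho$, $$\langle\theta-x_\rho,\,y_\rho-w\rangle\ge\Delta\|\theta-x_\rho\|^2.$$ (3) If $\zeta=w$, then for every $\rho>0$ one has $x_\rho=\theta$, $y_\rho=\zeta$, and $\langle\theta-x_\rho,y_\rho-w\rangle\ge\Delta\|\theta-x_\rho\|^2$ holds. *)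

theory Defs
  imports "HOL-Analysis.Analysis"
begin

(* Monotonicity in the sense of operator theory on a real inner product space;
   the constant mono of HOL is order monotonicity, which is unrelated. *)
definition monotone_operator :: "('a::real_inner \<Rightarrow> 'a) \<Rightarrow> bool" where
  "monotone_operator T \<longleftrightarrow> (\<forall>x y. 0 \<le> inner (x - y) (T x - T y))"

end

theory Submission
  imports Defs
begin

text \<open>
  Write \<open>v = \<zeta> - w\<close>. Since \<open>\<theta> - x\<^sub>\<rho> = \<rho> v\<close> and \<open>y\<^sub>\<rho> - w = v - \<rho> T\<^sup>l v\<close>, the
  inequality to be proved reads \<open>\<rho> (\<parallel>v\<parallel>\<^sup>2 - \<rho> \<langle>v, T\<^sup>l v\<rangle>) \<ge> \<Delta> \<rho>\<^sup>2 \<parallel>v\<parallel>\<^sup>2\<close>, which for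
  \<open>\<rho> > 0\<close> is linear in \<open>\<rho>\<close> and amounts to \<open>\<rho> \<le> \<rho>t\<close>. The bounds on \<open>\<rho>t\<close> come from
  \<open>0 \<le> \<langle>v, T\<^sup>l v\<rangle> \<le> L \<parallel>v\<parallel>\<^sup>2\<close>, that is, from monotonicity and the Lipschitz property.
\<close>

text \<open>Monotonicity is tested on the pair \<open>v\<close>, \<open>0\<close>: the constant
  \<open>c\<close> cancels in \<open>T v - T 0\<close>, leaving \<open>Tl v\<close>.\<close>

lemma monotone_operator_affine_linear_part_nonneg:
  assumes "monotone_operator T" and "linear Tl" and "\<And>u. T u = Tl u + c"
  shows "0 \<le> inner v (Tl v)"
proof -
  have "0 \<le> inner (v - 0) (T v - T 0)"
    using assms(1) unfolding monotone_operator_def by blast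
  then show ?thesis
    by (simp add: assms(3) linear_0[OF assms(2)])
qed

lemma lipschitz_affine_linear_part_norm_le:
  fixes T Tl :: "'a::real_normed_vector \<Rightarrow> 'b::real_normed_vector"
  assumes "L-lipschitz_on UNIV T" and "linear Tl" and "\<And>u. T u = Tl u + c"
  shows "norm (Tl v) \<le> L * norm v"
  using lipschitz_onD[OF assms(1), of v 0]
  by (simp add: dist_norm assms(3) linear_0[OF assms(2)])

lemma inner_linear_le_of_norm_le:
  fixes Tl :: "'a::real_inner \<Rightarrow> 'a"
  assumes "norm (Tl v) \<le> L * norm v"
  shows "inner v (Tl v) \<le> L * (norm v)\<^sup>2"
proof -
  have "inner v (Tl v) \<le> norm v * norm (Tl v)"
    by (rule norm_cauchy_schwarz)
  also have "\<dots> \<le> norm v * (L * norm v)"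
    by (rule mult_left_mono[OF assms]) simp
  finally show ?thesis
    by (simp add: power2_eq_square mult_ac)
qed

text \<open>The bounds on \<open>a\<close> place the denominator between \<open>\<Delta> * n\<close>
  and \<open>(\<Delta> + L) * n\<close>. Applied with \<open>n\<close> the squared norm of
  \<open>v\<close> and \<open>a = inner v (Tl v)\<close>.\<close>

lemma divide_add_bounds:
  fixes n a L \<Delta> :: real
  assumes "n > 0" "\<Delta> > 0" "L \<ge> 0" "0 \<le> a" "a \<le> L * n"
  shows "n / (\<Delta> * n + a) \<in> {1 / (\<Delta> + L) .. 1 / \<Delta>}"
proof -
  have "\<Delta> * n + a > 0" "\<Delta> + L > 0"
    using assms by (simp_all add: add_pos_nonneg)
  then show ?thesis
    using assms by (simp add: field_simps)
qed

text \<open>The right side minus the left side of the conclusion is exactly \<open>\<rho>\<close>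
  times the slack in the second hypothesis.\<close>

lemma step_inequality:
  fixes v z :: "'a::real_inner"
  assumes "0 < \<rho>" and "\<rho> * (\<Delta> * (norm v)\<^sup>2 + inner v z) \<le> (norm v)\<^sup>2"
  shows "\<Delta> * (norm (\<rho> *\<^sub>R v))\<^sup>2 \<le> inner (\<rho> *\<^sub>R v) (v - \<rho> *\<^sub>R z)"
proof -
  have "0 \<le> \<rho> * ((norm v)\<^sup>2 - \<rho> * (\<Delta> * (norm v)\<^sup>2 + inner v z))"
    using assms by simp
  then show ?thesis
    using assms(1)
    by (simp add: inner_diff_right dot_square_norm power2_eq_square algebra_simps)
qed

theorem mainTheorem3:
  fixes T Tl :: "'a::{real_inner,complete_space} \<Rightarrow> 'a"
    and c \<theta> w \<zeta> :: 'a
    and L \<Delta> :: real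
    and x y :: "real \<Rightarrow> 'a"
  assumes "monotone_operator T"
    and "L \<ge> 0" and "L-lipschitz_on UNIV T"
    and "linear Tl" and "\<And>u. T u = Tl u + c"
    and "\<Delta> > 0"
    and "\<zeta> = T \<theta>"
    and "\<And>\<rho>. \<rho> > 0 \<Longrightarrow> x \<rho> = \<theta> - \<rho> *\<^sub>R (\<zeta> - w)"
    and "\<And>\<rho>. \<rho> > 0 \<Longrightarrow> y \<rho> = T (x \<rho>)"
  shows "(\<forall>\<rho>>0. y \<rho> = \<zeta> - \<rho> *\<^sub>R Tl (\<zeta> - w))
    \<and> (\<zeta> \<noteq> w \<longrightarrow>
        (let \<rho>t = (norm (\<zeta> - w))\<^sup>2 / (\<Delta> * (norm (\<zeta> - w))\<^sup>2 + inner (\<zeta> - w) (Tl (\<zeta> - w)))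
         in \<rho>t \<in> {1 / (\<Delta> + L) .. 1 / \<Delta>}
          \<and> (\<forall>\<rho>. 0 < \<rho> \<and> \<rho> \<le> \<rho>t \<longrightarrow>
               inner (\<theta> - x \<rho>) (y \<rho> - w) \<ge> \<Delta> * (norm (\<theta> - x \<rho>))\<^sup>2)))
    \<and> (\<zeta> = w \<longrightarrow>
        (\<forall>\<rho>>0. x \<rho> = \<theta> \<and> y \<rho> = \<zeta>
          \<and> inner (\<theta> - x \<rho>) (y \<rho> - w) \<ge> \<Delta> * (norm (\<theta> - x \<rho>))\<^sup>2))"
proof -
  define v where "v = \<zeta> - w"
  \<comment> \<open>Linearity splits \<open>Tl (\<theta> - \<rho> *\<^sub>R v)\<close>, and
    \<open>Tl \<theta> + c\<close> is \<open>\<zeta>\<close>.\<close>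
  have y_eq: "y \<rho> = \<zeta> - \<rho> *\<^sub>R Tl v" if "\<rho> > 0" for \<rho>
    using that assms(5,7-9)
    by (simp add: v_def linear_diff[OF assms(4)] linear_scale[OF assms(4)])
  have theta_diff: "\<theta> - x \<rho> = \<rho> *\<^sub>R v" if "\<rho> > 0" for \<rho>
    using assms(8)[OF that] by (simp add: v_def)
  have y_diff: "y \<rho> - w = v - \<rho> *\<^sub>R Tl v" if "\<rho> > 0" for \<rho>
    using y_eq[OF that] by (simp add: v_def)
  have nonneg: "0 \<le> inner v (Tl v)"
    using monotone_operator_affine_linear_part_nonneg assms(1,4,5) .
  have upper: "inner v (Tl v) \<le> L * (norm v)\<^sup>2"
    by (intro inner_linear_le_of_norm_le lipschitz_affine_linear_part_norm_le) fact+
  define \<rho>t where "\<rho>t = (norm v)\<^sup>2 / (\<Delta> * (norm v)\<^sup>2 + inner v (Tl v))"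
  have part2: "\<rho>t \<in> {1 / (\<Delta> + L) .. 1 / \<Delta>}
      \<and> (\<forall>\<rho>. 0 < \<rho> \<and> \<rho> \<le> \<rho>t \<longrightarrow>
          \<Delta> * (norm (\<theta> - x \<rho>))\<^sup>2 \<le> inner (\<theta> - x \<rho>) (y \<rho> - w))" if "\<zeta> \<noteq> w"
  proof (intro conjI allI impI)
    have pos: "(norm v)\<^sup>2 > 0"
      using that by (simp add: v_def)
    then show "\<rho>t \<in> {1 / (\<Delta> + L) .. 1 / \<Delta>}"
      unfolding \<rho>t_def using assms(2,6) nonneg upper by (intro divide_add_bounds)
    fix \<rho> assume \<rho>: "0 < \<rho> \<and> \<rho> \<le> \<rho>t"
    \<comment> \<open>A positive denominator turns \<open>\<rho> \<le> \<rho>t\<close> into the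
      division-free hypothesis of \<open>step_inequality\<close>.\<close>
    have "\<Delta> * (norm v)\<^sup>2 + inner v (Tl v) > 0"
      using pos assms(6) nonneg by (simp add: add_pos_nonneg)
    then have "\<rho> * (\<Delta> * (norm v)\<^sup>2 + inner v (Tl v)) \<le> (norm v)\<^sup>2"
      using \<rho> by (simp add: \<rho>t_def pos_le_divide_eq)
    then show "\<Delta> * (norm (\<theta> - x \<rho>))\<^sup>2 \<le> inner (\<theta> - x \<rho>) (y \<rho> - w)"
      using \<rho> by (simp only: theta_diff y_diff step_inequality)
  qed
  have part3: "x \<rho> = \<theta> \<and> y \<rho> = \<zeta>" if "\<zeta> = w" "\<rho> > 0" for \<rho>
    using that assms(7-9) by simp
  \<comment> \<open>In the case \<open>\<zeta> = w\<close> the remaining inequality reads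
    \<open>0 \<ge> 0\<close>, because \<open>x \<rho> = \<theta>\<close>.\<close>
  show ?thesis
    using y_eq part2 part3 by (simp add: Let_def v_def \<rho>t_def)
qed

end
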